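(* Let $n\ge 4$ be an integer and let $v_i$ be the prime Jaconian vertex of the finite Jaco graph $J_n(1)$. Then $$h(J^{\ast}_{n+1}(1))=h(J^{\ast}_n(1))+\sum_{j=1}^{(n-i)-1}\big((n-i)-j\big).$$
   Context: The infinite Jaco graph $J_\infty(1)$ is the directed graph with vertex set $\{v_k : k\in\mathbb{N}\}$ (with $\mathbb{N}=\{1,2,\dots\}$) whose arcs are defined as follows: for $k<j$, $(v_k,v_j)$ is an arc if and only if $2k-d^-(v_k)\ge j$, where $d^-(v_k)$ is the in-degree of $v_k$ in $J_\infty(1)$ (this is well defined recursively, since $d^-(v_k)$ depends only on arcs from vertices of smaller index); there are no arcs $(v_k,v_j)$ with $k\ge j$. For $n\in\mathbb{N}$, the finite Jaco graph $J_n(1)$ is the subdigraph of $J_\infty(1)$ induced by $v_1,\dots,v_n$, and $J^{\ast}_n(1)$ denotes its underlying undirected (simple) graph. The degree of a vertex in $J_n(1)$ is its degree in $J^{\ast}_n(1)$; the Jaconian vertices of $J_n(1)$ are the vertices attaining the maximum degree $\Delta(J_n(1))$, and the prime Jaconian vertex is the Jaconian vertex of smallest index. $h(G)$ denotes the number of triangles ($C_3$'s) in a graph $G$. *)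

theory Defs
  imports "Graph_Theory.Graph_Theory"
begin

text \<open>
  The arcs of the infinite Jaco graph depend on its own in-degrees, so the in-degrees are
  introduced first, by well-founded recursion. The lemmas \<open>in_degree_jaco_inf\<close> and
  \<open>jaco_inf_arc_iff\<close> below confirm that they are the in-degrees of the resulting digraph and
  that its arcs are given by the self-referential condition $2k - d^-(v_k) \ge j$.
  The vertex $v_k$ is represented by its index $k \ge 1$.
\<close>

context
  notes conj_cong [fundef_cong]
begin

fun jaco_indeg :: "nat \<Rightarrow> nat" where
  "jaco_indeg k = card {m. 1 \<le> m \<and> m < k \<and> int k \<le> 2 * int m - int (jaco_indeg m)}"

end

declare jaco_indeg.simps [simp del]

definition jaco_inf :: "nat pair_pre_digraph" where
  "jaco_inf = \<lparr> pverts = {k. 1 \<le> k},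
     parcs = {(k, j). 1 \<le> k \<and> k < j \<and> int j \<le> 2 * int k - int (jaco_indeg k)} \<rparr>"

lemma in_degree_jaco_inf: "in_degree jaco_inf k = jaco_indeg k"
proof -
  have "in_arcs jaco_inf k
      = (\<lambda>m. (m, k)) ` {m. 1 \<le> m \<and> m < k \<and> int k \<le> 2 * int m - int (jaco_indeg m)}"
    by (auto simp: in_arcs_def jaco_inf_def)
  then show ?thesis
    by (simp add: in_degree_def card_image inj_on_def jaco_indeg.simps [of k])
qed

lemma jaco_inf_arc_iff:
  "(k, j) \<in> parcs jaco_inf
    \<longleftrightarrow> 1 \<le> k \<and> k < j \<and> 2 * int k - int (in_degree jaco_inf k) \<ge> int j"
  by (simp add: in_degree_jaco_inf) (simp add: jaco_inf_def)

definition jaco :: "nat \<Rightarrow> (nat, nat \<times> nat) pre_digraph" where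
  "jaco n = jaco_inf \<restriction> {1..n}"

text \<open>
  Undirected simple graphs are represented, as usual in this library, by symmetric digraphs:
  an edge $uv$ is the pair of arcs $(u,v)$, $(v,u)$.
\<close>

definition jaco_und :: "nat \<Rightarrow> nat pair_pre_digraph" where
  "jaco_und n = mk_symmetric (jaco n)"

text \<open>In a symmetric digraph without parallel arcs, the out-degree is the undirected degree.\<close>

definition jaco_degree :: "nat \<Rightarrow> nat \<Rightarrow> nat" where
  "jaco_degree n v = out_degree (jaco_und n) v"

definition jaco_max_degree :: "nat \<Rightarrow> nat" where
  "jaco_max_degree n = Max (jaco_degree n ` verts (jaco n))"

definition jaconian :: "nat \<Rightarrow> nat set" where
  "jaconian n = {v \<in> verts (jaco n). jaco_degree n v = jaco_max_degree n}"

definition prime_jaconian :: "nat \<Rightarrow> nat \<Rightarrow> bool" where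
  "prime_jaconian n i \<longleftrightarrow> i \<in> jaconian n \<and> (\<forall>v \<in> jaconian n. i \<le> v)"

text \<open>A triangle of a simple graph is determined by its vertex set.\<close>

definition triangles :: "'a pair_pre_digraph \<Rightarrow> 'a set set" where
  "triangles G = {T. T \<subseteq> pverts G \<and> card T = 3 \<and>
     (\<forall>u \<in> T. \<forall>v \<in> T. u \<noteq> v \<longrightarrow> (u, v) \<in> parcs G)}"

definition num_triangles :: "'a pair_pre_digraph \<Rightarrow> nat" where
  "num_triangles G = card (triangles G)"

end

theory Submission
  imports Defs
begin

text \<open>
  Let \<open>r k = 2k - d k\<close> be the last out-neighbour of \<open>k\<close>, where \<open>d\<close> is the in-degree. Since
  \<open>d (k + 1) \<le> d k + 1\<close>, both \<open>r\<close> (strictly) and \<open>k - d k\<close> (weakly) increase. Let \<open>c\<close> be the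
  largest vertex with \<open>r c \<le> n\<close>. A vertex \<open>v \<le> c\<close> has all its out-neighbours in \<open>J\<^sub>n\<close> and hence
  degree \<open>v\<close>, while \<open>v > c\<close> is joined to every later vertex and has degree \<open>n - (v - d v) \<le> c\<close>;
  so \<open>c\<close> is the prime Jaconian vertex. The neighbours of \<open>n + 1\<close> in \<open>J\<^sub>n\<^sub>+\<^sub>1\<close> are exactly
  \<open>c + 1, \<dots>, n\<close>, and they form a clique, so \<open>n + 1\<close> adds \<open>n - c\<close> choose \<open>2\<close> triangles.
\<close>

definition jaco_reach :: "nat \<Rightarrow> nat" where
  "jaco_reach k = 2 * k - jaco_indeg k"

lemma jaco_indeg_le: "jaco_indeg k \<le> k - 1"
proof -
  have "jaco_indeg k \<le> card {1..<k}"
    by (subst jaco_indeg.simps) (rule card_mono, auto)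
  then show ?thesis by simp
qed

text \<open>As \<open>jaco_indeg k \<le> k - 1\<close>, the natural subtraction in
  \<open>jaco_reach\<close> never truncates, so the integer arc condition turns into
  \<open>j \<le> jaco_reach k\<close>.\<close>

lemma int_jaco_reach: "2 * int k - int (jaco_indeg k) = int (jaco_reach k)"
  using jaco_indeg_le[of k] by (simp add: jaco_reach_def)

lemma jaco_indeg_eq_card: "jaco_indeg k = card {m. 1 \<le> m \<and> m < k \<and> k \<le> jaco_reach m}"
  by (subst jaco_indeg.simps) (simp add: int_jaco_reach)

text \<open>An in-neighbour of \<open>Suc k\<close> other than \<open>k\<close> reaches past
  \<open>k\<close>, hence is an in-neighbour of \<open>k\<close> too.\<close>

lemma jaco_indeg_Suc_le: "jaco_indeg (Suc k) \<le> Suc (jaco_indeg k)"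
proof -
  let ?A = "{m. 1 \<le> m \<and> m < k \<and> k \<le> jaco_reach m}"
  have "jaco_indeg (Suc k) \<le> card (insert k ?A)"
    unfolding jaco_indeg_eq_card[of "Suc k"] by (rule card_mono) auto
  also have "\<dots> \<le> Suc (card ?A)"
    by (simp add: card_insert_if)
  finally show ?thesis by (simp add: jaco_indeg_eq_card[of k])
qed

lemma jaco_indeg_le_add_diff: "m \<le> k \<Longrightarrow> jaco_indeg k \<le> jaco_indeg m + (k - m)"
proof (induction k rule: dec_induct)
  case (step k)
  then show ?case using jaco_indeg_Suc_le[of k] by simp
qed simp

text \<open>One step adds 2 to \<open>2 * k\<close> and at most 1 to the in-degree.\<close>

lemma strict_mono_jaco_reach: "strict_mono jaco_reach"
  unfolding strict_mono_Suc_iff jaco_reach_def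
proof
  fix k
  show "2 * k - jaco_indeg k < 2 * Suc k - jaco_indeg (Suc k)"
    using jaco_indeg_Suc_le[of k] jaco_indeg_le[of k] by (simp add: less_diff_conv)
qed

lemma parcs_jaco_und:
  "(u, v) \<in> parcs (jaco_und n) \<longleftrightarrow>
    u \<in> {1..n} \<and> v \<in> {1..n} \<and> (u < v \<and> v \<le> jaco_reach u \<or> v < u \<and> u \<le> jaco_reach v)"
  by (auto simp: jaco_und_def mk_symmetric_def jaco_def induce_subgraph_def arcs_ends_def
      arc_to_ends_def jaco_inf_def int_jaco_reach)

lemma pverts_jaco_und: "pverts (jaco_und n) = {1..n}"
  by (simp add: jaco_und_def mk_symmetric_def jaco_def)

lemma verts_jaco: "verts (jaco n) = {1..n}"
  by (simp add: jaco_def)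

text \<open>In-neighbours have smaller indices, so \<open>jaco n\<close> keeps them all;
  out-neighbours are cut off at \<open>n\<close>.\<close>

lemma jaco_degree_eq:
  assumes "v \<in> {1..n}"
  shows "jaco_degree n v = jaco_indeg v + (min n (jaco_reach v) - v)"
proof -
  let ?A = "{m. 1 \<le> m \<and> m < v \<and> v \<le> jaco_reach m}"
  have "out_arcs (jaco_und n) v = Pair v ` (?A \<union> {v<..min n (jaco_reach v)})"
    using assms by (auto simp: out_arcs_def parcs_jaco_und image_iff)
  moreover have "card (?A \<union> {v<..min n (jaco_reach v)})
      = card ?A + card {v<..min n (jaco_reach v)}"
    by (rule card_Un_disjoint) auto
  ultimately show ?thesis
    by (simp add: jaco_degree_def out_degree_def card_image inj_on_def jaco_indeg_eq_card[of v])
qed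

lemma prime_jaconian_eqI:
  assumes "prime_jaconian n i" and "c \<in> {1..n}"
    and "\<And>v. v \<in> {1..n} \<Longrightarrow> jaco_degree n v \<le> jaco_degree n c"
    and "\<And>v. v \<in> {1..n} \<Longrightarrow> jaco_degree n v = jaco_degree n c \<Longrightarrow> c \<le> v"
  shows "i = c"
proof -
  have "jaco_max_degree n = jaco_degree n c"
    unfolding jaco_max_degree_def verts_jaco using assms(2,3) by (intro Max_eqI) auto
  then have "jaconian n = {v \<in> {1..n}. jaco_degree n v = jaco_degree n c}"
    by (simp add: jaconian_def verts_jaco)
  with assms show ?thesis
    unfolding prime_jaconian_def by (intro antisym) auto
qed

lemma prime_jaconian_reach:
  assumes "n \<ge> 2" and "prime_jaconian n i"
  shows "i \<in> {1..n}" and "\<And>v. jaco_reach v \<le> n \<longleftrightarrow> v \<le> i"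
proof -
  have deg_le: "jaco_degree n v \<le> v" if "v \<in> {1..n}" for v
    using that jaco_indeg_le[of v] by (simp add: jaco_degree_eq jaco_reach_def)
  have "jaco_indeg 1 = 0"
    using jaco_indeg_le[of 1] by simp
  \<comment> \<open>\<open>jaco_reach 1\<close> is 2, so \<open>n \<ge> 2\<close> makes the
    \<open>c\<close> chosen below at least 1.\<close>
  then have one: "jaco_reach 1 \<le> n"
    using assms(1) by (simp add: jaco_reach_def)
  have bound: "v \<le> n" if "jaco_reach v \<le> n" for v
    using that jaco_indeg_le[of v] by (simp add: jaco_reach_def)
  define c where "c = (GREATEST v. jaco_reach v \<le> n)"
  have c_reach: "jaco_reach c \<le> n"
    unfolding c_def by (rule GreatestI_nat[where P = "\<lambda>v. jaco_reach v \<le> n", OF one bound])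
  have c_greatest: "v \<le> c" if "jaco_reach v \<le> n" for v
    unfolding c_def
    by (rule Greatest_le_nat[where P = "\<lambda>v. jaco_reach v \<le> n", OF that bound])
  have iff: "jaco_reach v \<le> n \<longleftrightarrow> v \<le> c" for v
    using c_reach c_greatest strict_mono_less_eq[OF strict_mono_jaco_reach, of v c] by auto
  have c: "c \<in> {1..n}"
    using bound[OF c_reach] c_greatest[OF one] by simp
  have deg_c: "jaco_degree n c = c"
    using c c_reach jaco_indeg_le[of c] by (simp add: jaco_degree_eq jaco_reach_def min_def)
  have "jaco_degree n v \<le> c" if v: "v \<in> {1..n}" for v
  proof (cases "v \<le> c")
    case True
    then show ?thesis using deg_le[OF v] by simp
  next
    case False
    \<comment> \<open>The degree of \<open>v\<close> is at most
      \<open>jaco_indeg (Suc c) + n - Suc c\<close>; as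
      \<open>n < 2 * Suc c - jaco_indeg (Suc c)\<close>, this is at most \<open>c\<close>.\<close>
    then have "jaco_indeg v \<le> jaco_indeg (Suc c) + (v - Suc c)"
      by (intro jaco_indeg_le_add_diff) simp
    moreover have "n < jaco_reach (Suc c)"
      using iff[of "Suc c"] by simp
    moreover have "jaco_degree n v \<le> jaco_indeg v + (n - v)"
      unfolding jaco_degree_eq[OF v] by (intro add_left_mono diff_le_mono) simp
    ultimately show ?thesis
      using v False by (simp add: jaco_reach_def)
  qed
  \<comment> \<open>By \<open>deg_le\<close>, a vertex of degree \<open>c\<close> has index at least
    \<open>c\<close>, so \<open>c\<close> is the least vertex of maximum degree.\<close>
  then have "i = c"
    using c deg_c deg_le by (intro prime_jaconian_eqI[OF assms(2)]) fastforce+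
  with c iff show "i \<in> {1..n}" and "\<And>v. jaco_reach v \<le> n \<longleftrightarrow> v \<le> i" by simp_all
qed

text \<open>Replacing \<open>j\<close> by \<open>k - j\<close> reverses the sum into the Gauss sum
  up to \<open>k - 1\<close>.\<close>

lemma sum_diff_eq_choose_two: "(\<Sum>j = 1..k - 1. k - j) = k choose 2"
proof -
  have "(\<Sum>j = 1..k - 1. k - j) = \<Sum> {1..k - 1}"
    by (rule sum.reindex_bij_witness[of _ "\<lambda>j. k - j" "\<lambda>j. k - j"]) auto
  also have "\<dots> = k choose 2"
    using gauss_sum_from_Suc_0[of "k - 1", where ?'a = nat]
    by (cases k) (simp_all add: choose_two)
  finally show ?thesis .
qed

lemma finite_triangles: "finite (pverts G) \<Longrightarrow> finite (triangles G)"
  by (rule finite_subset[of _ "Pow (pverts G)"]) (auto simp: triangles_def)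

theorem theorem3p3:
  fixes n i :: nat
  assumes "n \<ge> 4" and "prime_jaconian n i"
  shows "num_triangles (jaco_und (n + 1))
    = num_triangles (jaco_und n) + (\<Sum>j = 1..(n - i) - 1. (n - i) - j)"
proof -
  have i: "i \<in> {1..n}" and reach: "\<And>v. jaco_reach v \<le> n \<longleftrightarrow> v \<le> i"
    using prime_jaconian_reach[OF _ assms(2)] assms(1) by auto
  have arc_old: "(u, v) \<in> parcs (jaco_und (n + 1)) \<longleftrightarrow> (u, v) \<in> parcs (jaco_und n)"
    if "u \<noteq> n + 1" "v \<noteq> n + 1" for u v
    using that by (auto simp: parcs_jaco_und)
  \<comment> \<open>For \<open>v \<le> n\<close>, being joined to \<open>n + 1\<close> means
    \<open>jaco_reach v > n\<close>, which is \<open>i < v\<close> by \<open>reach\<close>.\<close>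
  have arc_new: "(n + 1, v) \<in> parcs (jaco_und (n + 1)) \<longleftrightarrow> v \<in> {i<..n}"
      "(v, n + 1) \<in> parcs (jaco_und (n + 1)) \<longleftrightarrow> v \<in> {i<..n}" for v
    using i reach[of v] by (auto simp: parcs_jaco_und)
  \<comment> \<open>A vertex beyond \<open>i\<close> reaches past \<open>n\<close>, so it is joined
    to every later vertex.\<close>
  have clique: "(u, v) \<in> parcs (jaco_und (n + 1))" if "u \<in> {i<..n}" "v \<in> {i<..n}" "u \<noteq> v" for u v
    using that i reach[of u] reach[of v] by (auto simp: parcs_jaco_und)
  \<comment> \<open>The members of \<open>P\<close> are the sides opposite \<open>n + 1\<close> in
    the new triangles.\<close>
  define P where "P = {S. S \<subseteq> {i<..n} \<and> card S = 2}"
  have P: "finite S" "n + 1 \<notin> S" if "S \<in> P" for S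
    using that by (auto simp: P_def intro: finite_subset)
  have "T \<in> triangles (jaco_und (n + 1)) \<longleftrightarrow>
      T \<in> triangles (jaco_und n) \<union> insert (n + 1) ` P" for T
  proof (cases "n + 1 \<in> T")
    case False
    then have "T \<subseteq> {1..n + 1} \<longleftrightarrow> T \<subseteq> {1..n}"
      by (auto simp: subset_iff le_Suc_eq)
    moreover have "(u, v) \<in> parcs (jaco_und (n + 1)) \<longleftrightarrow> (u, v) \<in> parcs (jaco_und n)"
      if "u \<in> T" "v \<in> T" for u v
      using that False by (intro arc_old) auto
    ultimately show ?thesis
      using False by (auto simp: triangles_def pverts_jaco_und)
  next
    case True
    define S where "S = T - {n + 1}"
    have T: "T = insert (n + 1) S" and S: "n + 1 \<notin> S"
      using True by (auto simp: S_def)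
    have "T \<notin> triangles (jaco_und n)"
      using True by (auto simp: triangles_def pverts_jaco_und)
    \<comment> \<open>No member of \<open>P\<close> contains \<open>n + 1\<close>, so removing
      \<open>n + 1\<close> from a new triangle recovers its pair.\<close>
    moreover have "T \<in> insert (n + 1) ` P \<longleftrightarrow> S \<in> P"
      unfolding T using S P(2) by (auto simp: insert_ident)
    moreover have "T \<in> triangles (jaco_und (n + 1)) \<longleftrightarrow> S \<in> P"
    proof
      assume tri: "T \<in> triangles (jaco_und (n + 1))"
      then have "finite T"
        by (auto simp: triangles_def intro: card_ge_0_finite)
      then have "card S = 2"
        using tri True by (simp add: S_def triangles_def)
      moreover have "v \<in> {i<..n}" if "v \<in> S" for v
        using tri that True arc_new(1)[of v] by (auto simp: triangles_def S_def)
      ultimately show "S \<in> P"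
        by (auto simp: P_def)
    next
      assume "S \<in> P"
      then have sub: "S \<subseteq> {i<..n}" and "card T = 3"
        using P(1)[of S] S by (auto simp: P_def T)
      moreover have "(u, v) \<in> parcs (jaco_und (n + 1))" if "u \<in> T" "v \<in> T" "u \<noteq> v" for u v
        using that sub arc_new clique unfolding T by blast
      moreover have "T \<subseteq> {1..n + 1}"
        using sub unfolding T by fastforce
      ultimately show "T \<in> triangles (jaco_und (n + 1))"
        by (simp add: triangles_def pverts_jaco_und)
    qed
    ultimately show ?thesis by simp
  qed
  then have "triangles (jaco_und (n + 1)) = triangles (jaco_und n) \<union> insert (n + 1) ` P"
    by blast
  moreover have "triangles (jaco_und n) \<inter> insert (n + 1) ` P = {}"
    by (auto simp: triangles_def pverts_jaco_und)
  moreover have "finite P"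
    by (rule finite_subset[of _ "Pow {i<..n}"]) (auto simp: P_def)
  moreover have "card (insert (n + 1) ` P) = (n - i) choose 2"
  proof -
    have "inj_on (insert (n + 1)) P"
      using P(2) by (auto simp: inj_on_def insert_ident)
    then show ?thesis
      using n_subsets[of "{i<..n}" 2] by (simp add: card_image P_def)
  qed
  ultimately show ?thesis
    unfolding num_triangles_def sum_diff_eq_choose_two
    by (simp add: card_Un_disjoint finite_triangles pverts_jaco_und)
qed

end
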